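(* For every positive integer $n$, the critical exponent satisfies $m(n)\ge n-2$.
   Context: A real $n$-by-$n$ matrix is doubly nonnegative if it is symmetric, positive semidefinite, and entry-wise nonnegative. For positive semidefinite $A=\sum_i\lambda_ix_ix_i^T$ (orthonormal eigenvectors) and $t>0$, $A^t=\sum_i\lambda_i^tx_ix_i^T$. The (conventional) critical exponent $m(n)$ is the least value $m$ such that $A^t$ is doubly nonnegative for all $t\ge m$ and all $n$-by-$n$ doubly nonnegative matrices $A$. *)

theory Defs
  imports "HOL-Analysis.Analysis"
begin

text \<open>n-by-n real matrices are rendered as real^'n^'n, with n = CARD('n).\<close>

definition doubly_nonnegative :: "real^'n^'n \<Rightarrow> bool" where
  "doubly_nonnegative A \<longleftrightarrow>
     transpose A = A \<and>
     (\<forall>x. 0 \<le> x \<bullet> (A *v x)) \<and>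
     (\<forall>i j. 0 \<le> A $ i $ j)"

definition outer_prod :: "real^'n \<Rightarrow> real^'n^'n" where
  "outer_prod x = (\<chi> i j. x $ i * x $ j)"

text \<open>Spectral decomposition with orthonormal eigenvectors x i and eigenvalues l i.\<close>
definition spectral_decomp :: "real^'n^'n \<Rightarrow> ('n \<Rightarrow> real) \<Rightarrow> ('n \<Rightarrow> real^'n) \<Rightarrow> bool" where
  "spectral_decomp A l x \<longleftrightarrow>
     (\<forall>i j. x i \<bullet> x j = (if i = j then 1 else 0)) \<and>
     A = (\<Sum>i\<in>UNIV. l i *\<^sub>R outer_prod (x i))"

text \<open>Real power of a positive semidefinite matrix: A^t = sum l_i^t x_i x_i^T
  (well defined, independent of the chosen decomposition, for PSD A and t > 0).\<close>
definition mat_rpow :: "real^'n^'n \<Rightarrow> real \<Rightarrow> real^'n^'n" where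
  "mat_rpow A t = (SOME B. \<exists>l x. spectral_decomp A l x \<and> (\<forall>i. 0 \<le> l i) \<and>
                     B = (\<Sum>i\<in>UNIV. (l i powr t) *\<^sub>R outer_prod (x i)))"

text \<open>Conventional critical exponent m(n) for n = CARD('n): the infimum (least value)
  of the exponents m > 0 such that A^t is doubly nonnegative for all t \<ge> m and all
  doubly nonnegative A; taken in ereal (infinity if no such m exists).\<close>
definition critical_exponent :: "'n::finite itself \<Rightarrow> ereal" where
  "critical_exponent _ = Inf (ereal ` {m. 0 < m \<and>
      (\<forall>t\<ge>m. \<forall>A::real^'n^'n. doubly_nonnegative A \<longrightarrow> doubly_nonnegative (mat_rpow A t))})"

end

theory Submission
  imports Defs
begin

text \<open>Let \<open>A = M M\<^sup>T + I\<close>, where \<open>M\<close> is the 0/1 upper bidiagonal matrix for some ordering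
  \<open>1, \<dots>, n\<close> of the indices. \<open>A\<close> is tridiagonal, doubly nonnegative and positive definite, so
  its corner entry \<open>g t = (A\<^sup>t)\<^sub>1\<^sub>n = \<Sum>\<^sub>i w\<^sub>i \<lambda>\<^sub>i\<^sup>t\<close> is an exponential sum with at most \<open>n\<close> exponents
  \<open>ln \<lambda>\<^sub>i\<close>. Since \<open>A\<^sup>k\<close> has bandwidth \<open>k\<close>, \<open>g\<close> vanishes at \<open>0, \<dots>, n - 2\<close> and is positive at \<open>n - 1\<close>.
  By Rolle's theorem a nonzero exponential sum with \<open>n\<close> exponents has fewer than \<open>n\<close> zeros counted
  with multiplicity; hence these zeros are simple and exhaust all zeros, and \<open>g\<close> is negative on
  \<open>(n - 3, n - 2)\<close>. So \<open>A\<^sup>t\<close> fails to be doubly nonnegative there.\<close>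

section \<open>Spectral decomposition of symmetric matrices\<close>

lemma outer_prod_nth [simp]: "outer_prod x $ i $ j = x $ i * x $ j"
  by (simp add: outer_prod_def)

lemma spectral_decomp_nth:
  assumes "spectral_decomp A l x"
  shows "A $ r $ c = (\<Sum>i\<in>UNIV. l i * x i $ r * x i $ c)"
  using assms unfolding spectral_decomp_def by (simp add: sum_component ac_simps)

lemma spectral_decomp_mult_vec:
  assumes "spectral_decomp A l x"
  shows "A *v v = (\<Sum>i\<in>UNIV. (l i * (x i \<bullet> v)) *\<^sub>R x i)"
proof -
  have "(A *v v) $ r = (\<Sum>i\<in>UNIV. l i * (x i \<bullet> v) * x i $ r)" for r
  proof -
    have "(A *v v) $ r = (\<Sum>c\<in>UNIV. \<Sum>i\<in>UNIV. l i * x i $ r * x i $ c * v $ c)"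
      by (simp add: matrix_vector_mult_def spectral_decomp_nth[OF assms] sum_distrib_right)
    also have "\<dots> = (\<Sum>i\<in>UNIV. \<Sum>c\<in>UNIV. l i * x i $ r * x i $ c * v $ c)"
      by (rule sum.swap)
    finally show ?thesis
      by (simp add: inner_vec_def sum_distrib_left sum_distrib_right ac_simps)
  qed
  then show ?thesis by (simp add: vec_eq_iff sum_component)
qed

lemma spectral_decomp_eigenvector:
  assumes "spectral_decomp A l x"
  shows "A *v x j = l j *\<^sub>R x j"
proof -
  have "(\<Sum>i\<in>UNIV. (l i * (x i \<bullet> x j)) *\<^sub>R x i) = (\<Sum>i\<in>UNIV. if i = j then l j *\<^sub>R x j else 0)"
    using assms unfolding spectral_decomp_def by (intro sum.cong) auto
  then show ?thesis unfolding spectral_decomp_mult_vec[OF assms] by simp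
qed

lemma orthonormal_sum_components:
  fixes x :: "'n::finite \<Rightarrow> real^'n"
  assumes "\<forall>i j. x i \<bullet> x j = (if i = j then 1 else 0)"
  shows "(\<Sum>i\<in>UNIV. x i $ r * x i $ c) = (if r = c then 1 else 0)"
proof -
  define X :: "real^'n^'n" where "X = (\<chi> r i. x i $ r)"
  have "transpose X ** X = mat 1"
    using assms by (simp add: vec_eq_iff X_def matrix_matrix_mult_def transpose_def mat_def inner_vec_def)
  then have "X ** transpose X = mat 1" using matrix_left_right_inverse by blast
  then have "(X ** transpose X) $ r $ c = mat 1 $ r $ c" by simp
  then show ?thesis by (simp add: X_def matrix_matrix_mult_def transpose_def mat_def)
qed

lemma orthonormal_expansion:
  fixes x :: "'n::finite \<Rightarrow> real^'n"
  assumes "\<forall>i j. x i \<bullet> x j = (if i = j then 1 else 0)"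
  shows "v = (\<Sum>i\<in>UNIV. (x i \<bullet> v) *\<^sub>R x i)"
proof -
  have "(\<Sum>i\<in>UNIV. (x i \<bullet> v) * x i $ r) = v $ r" for r
  proof -
    have "(\<Sum>i\<in>UNIV. (x i \<bullet> v) * x i $ r) = (\<Sum>c\<in>UNIV. v $ c * (\<Sum>i\<in>UNIV. x i $ r * x i $ c))"
      by (simp add: inner_vec_def sum_distrib_left sum_distrib_right ac_simps) (rule sum.swap)
    also have "\<dots> = (\<Sum>c\<in>UNIV. if r = c then v $ c else 0)"
      by (intro sum.cong) (auto simp: orthonormal_sum_components[OF assms])
    finally show ?thesis by simp
  qed
  then show ?thesis by (simp add: vec_eq_iff sum_component)
qed

lemma symmetric_matrix_inner:
  fixes A :: "real^'n^'n"
  assumes "transpose A = A"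
  shows "(A *v x) \<bullet> y = x \<bullet> (A *v y)"
  by (metis assms dot_lmul_matrix inner_commute vector_transpose_matrix)

lemma eq_0_if_linear_le_quadratic:
  fixes b K :: real
  assumes "\<And>s. s * b \<le> s\<^sup>2 * K"
  shows "b = 0"
proof -
  define e where "e = 1 / (\<bar>K\<bar> + 1)"
  have e: "0 < e" "e * K < 1"
    unfolding e_def by (auto simp: field_simps abs_if)
  have "e * b\<^sup>2 \<le> e * (e * K * b\<^sup>2)"
    using assms[of "e * b"] by (simp add: power2_eq_square algebra_simps)
  then have "b\<^sup>2 \<le> e * K * b\<^sup>2" using e by simp
  then have "(1 - e * K) * b\<^sup>2 \<le> 0" by (simp add: algebra_simps)
  then show ?thesis using e by (simp add: mult_le_0_iff)
qed

lemma symmetric_max_quadratic_form_orthogonal: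
  fixes A :: "real^'n^'n"
  assumes sym: "transpose A = A" and V: "subspace V" and x0: "x0 \<in> V" "x0 \<bullet> x0 = 1"
    and max: "\<forall>w\<in>V. w \<bullet> (A *v w) \<le> (x0 \<bullet> (A *v x0)) * (w \<bullet> w)"
    and y: "y \<in> V" "x0 \<bullet> y = 0"
  shows "x0 \<bullet> (A *v y) = 0"
proof -
  define M where "M = x0 \<bullet> (A *v x0)"
  have "s * (2 * (x0 \<bullet> (A *v y))) \<le> s\<^sup>2 * (M * (y \<bullet> y) - y \<bullet> (A *v y))" for s
  proof -
    let ?w = "x0 + s *\<^sub>R y"
    have "?w \<bullet> (A *v ?w) = M + 2 * s * (x0 \<bullet> (A *v y)) + s\<^sup>2 * (y \<bullet> (A *v y))"
      using symmetric_matrix_inner[OF sym, of y x0] unfolding M_def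
      by (simp add: matrix_vector_right_distrib matrix_vector_mult_scaleR inner_add_left
          inner_add_right algebra_simps power2_eq_square inner_commute)
    moreover have "?w \<bullet> ?w = 1 + s\<^sup>2 * (y \<bullet> y)"
      using x0(2) y(2)
      by (simp add: inner_add_left inner_add_right algebra_simps power2_eq_square inner_commute)
    moreover have "?w \<in> V" using x0 y V by (simp add: subspace_add subspace_scale)
    ultimately show ?thesis using max unfolding M_def by (force simp: algebra_simps)
  qed
  then show ?thesis using eq_0_if_linear_le_quadratic by fastforce
qed

lemma symmetric_invariant_subspace_eigenvector:
  fixes A :: "real^'n^'n"
  assumes sym: "transpose A = A" and V: "subspace V" and inv: "\<forall>v\<in>V. A *v v \<in> V"
    and v: "v \<in> V" "v \<noteq> 0"
  shows "\<exists>x\<in>V. x \<bullet> x = 1 \<and> A *v x = (x \<bullet> (A *v x)) *\<^sub>R x"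
proof -
  define q where "q w = w \<bullet> (A *v w)" for w
  define S where "S = V \<inter> sphere 0 1"
  have "compact S"
    unfolding S_def using closed_subspace[OF V] by (metis Int_commute compact_Int_closed compact_sphere)
  moreover have "v /\<^sub>R norm v \<in> S" using v V unfolding S_def by (simp add: subspace_scale)
  moreover have "continuous_on S q"
    unfolding q_def by (intro continuous_intros linear_continuous_on matrix_vector_mul_bounded_linear)
  ultimately obtain x0 where x0: "x0 \<in> S" "\<forall>y\<in>S. q y \<le> q x0"
    using continuous_attains_sup[of S q] by blast
  have x0V: "x0 \<in> V" and x0x0: "x0 \<bullet> x0 = 1"
    using x0 unfolding S_def by (auto simp: dot_square_norm)
  have max: "\<forall>w\<in>V. q w \<le> q x0 * (w \<bullet> w)"
  proof
    fix w assume "w \<in> V"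
    show "q w \<le> q x0 * (w \<bullet> w)"
    proof (cases "w = 0")
      case False
      then have "w /\<^sub>R norm w \<in> S" using \<open>w \<in> V\<close> V unfolding S_def by (simp add: subspace_scale)
      then have "q w / (norm w)\<^sup>2 \<le> q x0"
        using x0 by (force simp: q_def matrix_vector_mult_scaleR power2_eq_square field_simps)
      then show ?thesis using False by (simp add: field_simps dot_square_norm)
    qed (simp add: q_def)
  qed
  define z where "z = A *v x0 - q x0 *\<^sub>R x0"
  have "z \<in> V" unfolding z_def using inv x0V V by (simp add: subspace_diff subspace_scale)
  moreover have xz: "x0 \<bullet> z = 0" unfolding z_def q_def using x0x0 by (simp add: inner_diff_right)
  ultimately have "x0 \<bullet> (A *v z) = 0"
    using symmetric_max_quadratic_form_orthogonal[OF sym V x0V x0x0] max unfolding q_def by blast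
  then have "(z + q x0 *\<^sub>R x0) \<bullet> z = 0"
    using symmetric_matrix_inner[OF sym] unfolding z_def by simp
  then have "z = 0" using xz by (simp add: inner_add_left)
  then show ?thesis using x0V x0x0 unfolding z_def q_def by auto
qed

lemma symmetric_orthonormal_eigenvectors:
  fixes A :: "real^'n^'n"
  assumes sym: "transpose A = A"
  shows "k \<le> CARD('n) \<Longrightarrow> \<exists>E. finite E \<and> card E = k \<and>
     (\<forall>e\<in>E. \<forall>e'\<in>E. e \<bullet> e' = (if e = e' then 1 else 0)) \<and>
     (\<forall>e\<in>E. A *v e = (e \<bullet> (A *v e)) *\<^sub>R e)"
proof (induction k)
  case 0
  then show ?case by (intro exI[of _ "{}"]) auto
next
  case (Suc k)
  then obtain E where E: "finite E" "card E = k"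
     "\<forall>e\<in>E. \<forall>e'\<in>E. e \<bullet> e' = (if e = e' then 1 else 0)"
     "\<forall>e\<in>E. A *v e = (e \<bullet> (A *v e)) *\<^sub>R e" by auto
  define V where "V = {v. \<forall>e\<in>E. e \<bullet> v = 0}"
  have V: "subspace V" unfolding V_def subspace_def by (auto simp: inner_add_right)
  have "A *v v \<in> V" if "v \<in> V" for v
  proof -
    have "e \<bullet> (A *v v) = (e \<bullet> (A *v e)) * (e \<bullet> v)" if "e \<in> E" for e
      using symmetric_matrix_inner[OF sym, of e v] E(4) that by (metis inner_scaleR_left)
    then show ?thesis using that unfolding V_def by simp
  qed
  moreover obtain v where "v \<in> V" "v \<noteq> 0"
  proof -
    have "span E \<noteq> UNIV"
    proof
      assume "span E = UNIV"
      then have "CARD('n) \<le> card E" using dim_le_card[of UNIV E] E(1) by simp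
      then show False using E(2) Suc.prems by simp
    qed
    then obtain v where "v \<noteq> 0" "\<forall>x\<in>span E. v \<bullet> x = 0"
      using span_not_UNIV_orthogonal by blast
    moreover from this(2) have "\<forall>e\<in>E. e \<bullet> v = 0" by (simp add: inner_commute span_base)
    ultimately show ?thesis using that unfolding V_def by blast
  qed
  ultimately obtain x where x: "x \<in> V" "x \<bullet> x = 1" "A *v x = (x \<bullet> (A *v x)) *\<^sub>R x"
    using symmetric_invariant_subspace_eigenvector[OF sym V] by blast
  then have "x \<notin> E" "\<forall>e\<in>E. x \<bullet> e = 0 \<and> e \<bullet> x = 0"
    unfolding V_def by (auto simp: inner_commute)
  then show ?case using E x by (intro exI[of _ "insert x E"]) auto
qed

lemma spectral_decomp_exists:
  fixes A :: "real^'n^'n"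
  assumes sym: "transpose A = A"
  shows "\<exists>l x. spectral_decomp A l x"
proof -
  obtain E where E: "finite E" "card E = CARD('n)"
     "\<forall>e\<in>E. \<forall>e'\<in>E. e \<bullet> e' = (if e = e' then 1 else 0)"
     "\<forall>e\<in>E. A *v e = (e \<bullet> (A *v e)) *\<^sub>R e"
    using symmetric_orthonormal_eigenvectors[OF sym, of "CARD('n)"] by auto
  obtain x where x: "bij_betw x (UNIV :: 'n set) E"
    using finite_same_card_bij[of "UNIV :: 'n set" E] E by auto
  define l where "l i = x i \<bullet> (A *v x i)" for i
  have xE: "x i \<in> E" for i using x bij_betwE by blast
  have on: "\<forall>i j. x i \<bullet> x j = (if i = j then 1 else 0)"
    using E(3) xE x by (auto simp: bij_betw_def inj_on_def)
  have eig: "A *v x i = l i *\<^sub>R x i" for i using E(4) xE l_def by auto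
  have "A $ r $ c = (\<Sum>i\<in>UNIV. l i * x i $ r * x i $ c)" for r c
  proof -
    have "(\<Sum>i\<in>UNIV. l i * x i $ r * x i $ c) = (\<Sum>i\<in>UNIV. (A *v x i) $ r * x i $ c)"
      using eig by simp
    also have "\<dots> = (\<Sum>i\<in>UNIV. \<Sum>k\<in>UNIV. A $ r $ k * (x i $ k * x i $ c))"
      by (simp add: matrix_vector_mult_def sum_distrib_right mult.assoc)
    also have "\<dots> = (\<Sum>k\<in>UNIV. A $ r $ k * (\<Sum>i\<in>UNIV. x i $ k * x i $ c))"
      by (subst sum.swap) (simp add: sum_distrib_left)
    also have "\<dots> = (\<Sum>k\<in>UNIV. if k = c then A $ r $ k else 0)"
      by (intro sum.cong) (auto simp: orthonormal_sum_components[OF on])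
    finally show ?thesis by simp
  qed
  then have "A = (\<Sum>i\<in>UNIV. l i *\<^sub>R outer_prod (x i))"
    by (simp add: vec_eq_iff sum_component ac_simps)
  then show ?thesis using on unfolding spectral_decomp_def by blast
qed

section \<open>Zeros of exponential sums\<close>

definition exp_sum :: "('a \<Rightarrow> real) \<Rightarrow> ('a \<Rightarrow> real) \<Rightarrow> 'a set \<Rightarrow> real \<Rightarrow> real" where
  "exp_sum w s I t = (\<Sum>i\<in>I. w i * exp (s i * t))"

lemma has_real_derivative_exp_sum:
  "(exp_sum w s I has_real_derivative exp_sum (\<lambda>i. w i * s i) s I t) (at t)"
  unfolding exp_sum_def[abs_def]
  by (auto intro!: derivative_eq_intros DERIV_sum simp: algebra_simps)

lemma exp_sum_shift: "exp (c * t) * exp_sum w s I t = exp_sum w (\<lambda>i. s i + c) I t"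
  unfolding exp_sum_def sum_distrib_left
  by (rule sum.cong) (auto simp: exp_add[symmetric] algebra_simps)

lemma has_real_derivative_exp_sum_shift:
  assumes "finite I" "a \<in> I"
  shows "(exp_sum w (\<lambda>i. s i - s a) I has_real_derivative
           exp_sum (\<lambda>i. w i * (s i - s a)) (\<lambda>i. s i - s a) (I - {a}) t) (at t)"
proof -
  have "exp_sum (\<lambda>i. w i * (s i - s a)) (\<lambda>i. s i - s a) I t
      = exp_sum (\<lambda>i. w i * (s i - s a)) (\<lambda>i. s i - s a) (I - {a}) t"
    using assms by (simp add: exp_sum_def sum.remove)
  then show ?thesis using has_real_derivative_exp_sum by metis
qed

lemma Rolle_has_real_derivative:
  fixes f f' :: "real \<Rightarrow> real"
  assumes f': "\<And>x. (f has_real_derivative f' x) (at x)" and "a < b" "f a = f b"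
  shows "\<exists>z. a < z \<and> z < b \<and> f' z = 0"
proof -
  have "continuous_on {a..b} f"
    using f' by (meson DERIV_continuous continuous_at_imp_continuous_on)
  then obtain z where "a < z" "z < b" "DERIV f z :> 0"
    using Rolle[OF assms(2,3)] f' real_differentiable_def by blast
  then show ?thesis using DERIV_unique[OF _ f'[of z]] by auto
qed

lemma Rolle_card_zeros:
  fixes f f' :: "real \<Rightarrow> real"
  assumes f': "\<And>x. (f has_real_derivative f' x) (at x)"
  shows "\<lbrakk>finite Z; card Z = Suc k; \<forall>z\<in>Z. f z = 0\<rbrakk> \<Longrightarrow>
    \<exists>Z'. finite Z' \<and> card Z' = k \<and> (\<forall>z\<in>Z'. f' z = 0 \<and> z < Max Z)"
proof (induction k arbitrary: Z)
  case 0
  then show ?case by (intro exI[of _ "{}"]) auto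
next
  case (Suc k)
  define M where "M = Max Z"
  define Z0 where "Z0 = Z - {M}"
  have "M \<in> Z" using Suc.prems M_def by (metis Max_in card.empty nat.distinct(1))
  then have Z0: "finite Z0" "card Z0 = Suc k" using Suc.prems Z0_def by auto
  then have "Z0 \<noteq> {}" by auto
  obtain Z' where Z': "finite Z'" "card Z' = k" "\<forall>z\<in>Z'. f' z = 0 \<and> z < Max Z0"
    using Suc.IH[OF Z0(1,2)] Suc.prems(3) Z0_def by auto
  have "Max Z0 \<in> Z0" using Z0 \<open>Z0 \<noteq> {}\<close> by simp
  then have lt: "Max Z0 < M"
    using Z0_def M_def Suc.prems(1) by (metis DiffD1 DiffD2 Max_ge insertI1 order_le_neq_trans)
  obtain \<xi> where \<xi>: "Max Z0 < \<xi>" "\<xi> < M" "f' \<xi> = 0"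
    using Rolle_has_real_derivative[OF f' lt] \<open>Max Z0 \<in> Z0\<close> \<open>M \<in> Z\<close> Suc.prems(3) Z0_def by auto
  have "\<xi> \<notin> Z'" using Z'(3) \<xi>(1) by force
  then show ?case using Z' \<xi> lt M_def by (intro exI[of _ "insert \<xi> Z'"]) auto
qed

text \<open>Multiplying by \<open>exp (- s a * t)\<close> and differentiating removes the term \<open>a\<close>, while Rolle's
  theorem loses at most one zero.\<close>
lemma exp_sum_eq_0_if_card_zeros:
  assumes "finite I" "finite Z" "card I \<le> card Z" "\<forall>z\<in>Z. exp_sum w s I z = 0"
  shows "exp_sum w s I t = 0"
  using assms
proof (induction I arbitrary: w s Z t rule: finite_induct)
  case empty
  then show ?case by (simp add: exp_sum_def)
next
  case (insert a I)
  define h where "h = exp_sum w (\<lambda>i. s i - s a) (insert a I)"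
  define h' where "h' = exp_sum (\<lambda>i. w i * (s i - s a)) (\<lambda>i. s i - s a) I"
  have h_eq: "h x = exp (- s a * x) * exp_sum w s (insert a I) x" for x
    unfolding h_def exp_sum_shift by simp
  have h': "(h has_real_derivative h' x) (at x)" for x
    using has_real_derivative_exp_sum_shift[of "insert a I" a w s] insert.hyps
    unfolding h_def h'_def by simp
  obtain Z1 where Z1: "Z1 \<subseteq> Z" "card Z1 = Suc (card I)"
    using insert.prems(2) insert.hyps by (metis obtain_subset_with_card_n card_insert_disjoint)
  then have "finite Z1" "\<forall>z\<in>Z1. h z = 0"
    using insert.prems(1,3) h_eq finite_subset by auto
  then obtain Z' where "finite Z'" "card Z' = card I" "\<forall>z\<in>Z'. h' z = 0"
    using Rolle_card_zeros[OF h' _ Z1(2)] by blast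
  then have "h' x = 0" for x
    using insert.IH unfolding h'_def by simp
  then have "h t = h z" for z using DERIV_isconst_all h' by metis
  moreover obtain z where "z \<in> Z1" using Z1(2) by fastforce
  ultimately have "h t = 0" using \<open>\<forall>z\<in>Z1. h z = 0\<close> by metis
  then show ?case using h_eq by simp
qed

lemma card_image_of_nat_atMost: "card (real ` {..m}) = Suc m"
  by (simp add: card_image)

lemma exp_sum_deriv_nonzero_at_last_zero:
  assumes "finite I" "card I \<le> m + 2" and zeros: "\<forall>k\<le>m. exp_sum w s I (real k) = 0"
    and last: "exp_sum w s I (real m + 1) \<noteq> 0"
  shows "exp_sum (\<lambda>i. w i * s i) s I (real m) \<noteq> 0"
proof
  assume g'_m: "exp_sum (\<lambda>i. w i * s i) s I (real m) = 0"
  obtain a where a: "a \<in> I" using last by (force simp: exp_sum_def)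
  define h where "h = exp_sum w (\<lambda>i. s i - s a) I"
  define h' where "h' = exp_sum (\<lambda>i. w i * (s i - s a)) (\<lambda>i. s i - s a) (I - {a})"
  have h_eq: "h = (\<lambda>x. exp (- s a * x) * exp_sum w s I x)"
    unfolding h_def exp_sum_shift by simp
  have h': "(h has_real_derivative h' x) (at x)" for x
    using has_real_derivative_exp_sum_shift[OF assms(1) a] unfolding h_def h'_def .
  have "(h has_real_derivative exp (- s a * real m) * (exp_sum (\<lambda>i. w i * s i) s I (real m)
      - s a * exp_sum w s I (real m))) (at (real m))"
    unfolding h_eq by (auto intro!: derivative_eq_intros has_real_derivative_exp_sum simp: algebra_simps)
  then have "h' (real m) = 0"
    using DERIV_unique[OF h'] g'_m zeros by fastforce
  moreover obtain Z' where Z': "finite Z'" "card Z' = m" "\<forall>z\<in>Z'. h' z = 0 \<and> z < real m"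
  proof -
    have "Max (real ` {..m}) = real m" by (intro Max_eqI) auto
    moreover have "\<forall>z\<in>real ` {..m}. h z = 0" using zeros h_eq by auto
    ultimately show ?thesis
      using Rolle_card_zeros[OF h', of "real ` {..m}" m] that
      by (auto simp: card_image_of_nat_atMost)
  qed
  ultimately have "\<forall>z\<in>insert (real m) Z'. h' z = 0" "card (insert (real m) Z') = Suc m"
    by auto
  moreover have "card (I - {a}) \<le> Suc m" using assms(2) a by simp
  ultimately have "h' x = 0" for x
    unfolding h'_def using assms(1) Z'(1)
    by (intro exp_sum_eq_0_if_card_zeros[of _ "insert (real m) Z'"]) (auto simp: h'_def)
  then have "h (real m + 1) = h 0" using DERIV_isconst_all h' by metis
  then show False using zeros last h_eq by auto
qed

lemma exp_sum_zero_imp_nat: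
  assumes "finite I" "card I \<le> m + 2" and zeros: "\<forall>k\<le>m. exp_sum w s I (real k) = 0"
    and last: "exp_sum w s I (real m + 1) \<noteq> 0" and "exp_sum w s I z = 0"
  shows "z \<in> real ` {..m}"
proof (rule ccontr)
  assume z: "z \<notin> real ` {..m}"
  then have "card (insert z (real ` {..m})) = m + 2" by (simp add: card_image_of_nat_atMost)
  moreover have "\<forall>x\<in>insert z (real ` {..m}). exp_sum w s I x = 0" using zeros assms(5) by auto
  ultimately have "exp_sum w s I (real m + 1) = 0"
    using assms(1,2) by (intro exp_sum_eq_0_if_card_zeros[of _ "insert z (real ` {..m})"]) auto
  then show False using last by simp
qed

text \<open>The zeros \<open>0, \<dots>, m\<close> are all the zeros and \<open>m\<close> is a simple one, so the sign just left
  of \<open>m\<close> is opposite to the sign on \<open>(m, m + 1]\<close>.\<close>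
lemma exp_sum_neg_before_last_zero:
  assumes "finite I" "card I \<le> m + 2" and zeros: "\<forall>k\<le>m. exp_sum w s I (real k) = 0"
    and last: "0 < exp_sum w s I (real m + 1)"
    and t: "real m - 1 < t" "t < real m"
  shows "exp_sum w s I t < 0"
proof (rule ccontr)
  assume "\<not> exp_sum w s I t < 0"
  define g where "g = exp_sum w s I"
  have g': "(g has_real_derivative exp_sum (\<lambda>i. w i * s i) s I x) (at x)" for x
    unfolding g_def by (rule has_real_derivative_exp_sum)
  have cont: "isCont g x" for x using g' DERIV_isCont by blast
  have no_zero_near: "g z \<noteq> 0" if "real m - 1 < z" "z < real m + 1" "z \<noteq> real m" for z
  proof
    assume "g z = 0"
    then obtain k where "k \<le> m" "z = real k"
      using exp_sum_zero_imp_nat[OF assms(1,2) zeros] last unfolding g_def by force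
    with that show False by (cases "k = m") auto
  qed
  define d where "d = min (real m - t) 1"
  have "0 < d" using t d_def by simp
  moreover have "g (real m) \<le> g y" if y: "\<bar>real m - y\<bar> < d" for y
  proof (rule ccontr)
    assume "\<not> ?thesis"
    then have "g y < 0" using zeros g_def by simp
    moreover have "y \<noteq> real m" using zeros g_def \<open>g y < 0\<close> by auto
    ultimately consider "t \<le> y" "y < real m" | "real m < y" "y < real m + 1"
      using y d_def by fastforce
    then show False
    proof cases
      case 1
      then obtain z where "t \<le> z" "z \<le> y" "g z = 0"
        using IVT2[of g y 0 t] \<open>\<not> exp_sum w s I t < 0\<close> \<open>g y < 0\<close> cont g_def by auto
      then show False using no_zero_near[of z] 1 t by auto
    next
      case 2
      then obtain z where "y \<le> z" "z \<le> real m + 1" "g z = 0"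
        using IVT[of g y 0 "real m + 1"] last \<open>g y < 0\<close> cont g_def by auto
      then show False using no_zero_near[of z] 2 last g_def by (cases "z = real m + 1") auto
    qed
  qed
  ultimately have "exp_sum (\<lambda>i. w i * s i) s I (real m) = 0"
    using DERIV_local_min[OF g'] by blast
  then show False
    using exp_sum_deriv_nonzero_at_last_zero[OF assms(1,2) zeros] last by simp
qed

section \<open>Real powers and iterates of matrices\<close>

lemma mat_rpow_positive_definite:
  fixes A :: "real^'n^'n"
  assumes sym: "transpose A = A" and pd: "\<And>v. v \<noteq> 0 \<Longrightarrow> 0 < v \<bullet> (A *v v)"
  obtains l x where "spectral_decomp A l x" "\<forall>i. 0 < l i"
    "mat_rpow A t = (\<Sum>i\<in>UNIV. (l i powr t) *\<^sub>R outer_prod (x i))"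
proof -
  have pos: "\<forall>i. 0 < l i" if "spectral_decomp A l x" for l x
  proof
    fix i
    have "x i \<bullet> x i = 1" using that unfolding spectral_decomp_def by simp
    moreover have "x i \<bullet> (A *v x i) = l i * (x i \<bullet> x i)"
      using spectral_decomp_eigenvector[OF that] by simp
    ultimately show "0 < l i" using pd[of "x i"] by (metis inner_zero_left mult.right_neutral zero_neq_one)
  qed
  obtain l x where "spectral_decomp A l x" using spectral_decomp_exists[OF sym] by blast
  then have "\<exists>B l x. spectral_decomp A l x \<and> (\<forall>i. 0 \<le> l i) \<and>
      B = (\<Sum>i\<in>UNIV. (l i powr t) *\<^sub>R outer_prod (x i))"
    using pos by (meson less_imp_le)
  from someI_ex[OF this] show ?thesis
    using that pos unfolding mat_rpow_def by blast
qed

lemma spectral_decomp_iterate: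
  assumes "spectral_decomp A l x"
  shows "((*v) A ^^ k) v = (\<Sum>i\<in>UNIV. (l i ^ k * (x i \<bullet> v)) *\<^sub>R x i)"
proof (induction k)
  case 0
  show ?case using orthonormal_expansion assms unfolding spectral_decomp_def by auto
next
  case (Suc k)
  have "A *v (\<Sum>i\<in>UNIV. (l i ^ k * (x i \<bullet> v)) *\<^sub>R x i)
      = (\<Sum>i\<in>UNIV. (l i ^ k * (x i \<bullet> v)) *\<^sub>R (A *v x i))"
    by (simp add: linear_sum[OF matrix_vector_mul_linear] matrix_vector_mult_scaleR)
  then show ?case
    using Suc spectral_decomp_eigenvector[OF assms] by (simp add: ac_simps)
qed

text \<open>The decomposition chosen by \<open>mat_rpow\<close> may depend on \<open>t\<close>; the integer powers are
  expressed through the same decomposition, so \<open>w\<close> and \<open>s\<close> depend on \<open>t\<close> as well.\<close>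
lemma mat_rpow_nth_exp_sum:
  fixes A :: "real^'n^'n"
  assumes "transpose A = A" "\<And>v. v \<noteq> 0 \<Longrightarrow> 0 < v \<bullet> (A *v v)"
  shows "\<exists>w s :: 'n \<Rightarrow> real. mat_rpow A t $ a $ b = exp_sum w s UNIV t \<and>
    (\<forall>k. ((*v) A ^^ k) (axis b 1) $ a = exp_sum w s UNIV (real k))"
proof -
  obtain l x where lx: "spectral_decomp A l x" "\<forall>i. 0 < l i"
    and rpow: "mat_rpow A t = (\<Sum>i\<in>UNIV. (l i powr t) *\<^sub>R outer_prod (x i))"
    using mat_rpow_positive_definite[OF assms] by blast
  define w where "w i = x i $ a * x i $ b" for i
  have "mat_rpow A t $ a $ b = exp_sum w (\<lambda>i. ln (l i)) UNIV t"
    unfolding rpow exp_sum_def w_def using lx(2)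
    by (simp add: sum_component powr_def ac_simps less_imp_neq[symmetric])
  moreover have "((*v) A ^^ k) (axis b 1) $ a = exp_sum w (\<lambda>i. ln (l i)) UNIV (real k)" for k
  proof -
    have "exp (ln (l i) * real k) = l i ^ k" for i
      using lx(2) by (subst mult.commute) (simp add: exp_of_nat_mult)
    then show ?thesis
      unfolding spectral_decomp_iterate[OF lx(1)] exp_sum_def w_def
      by (simp add: sum_component inner_axis ac_simps)
  qed
  ultimately show ?thesis by blast
qed

lemma funpow_mult_vec_Suc_nth:
  "((*v) A ^^ Suc k) v $ i = (\<Sum>j\<in>UNIV. A $ i $ j * ((*v) A ^^ k) v $ j)"
  by (simp add: matrix_vector_mult_def)

lemma funpow_mult_vec_nonneg:
  fixes A :: "real^'n^'n"
  assumes "\<And>i j. 0 \<le> A $ i $ j" "\<And>i. 0 \<le> v $ i"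
  shows "0 \<le> ((*v) A ^^ k) v $ i"
proof (induction k arbitrary: i)
  case (Suc k)
  have "0 \<le> (\<Sum>j\<in>UNIV. A $ i $ j * ((*v) A ^^ k) v $ j)"
    using Suc.IH assms(1) by (intro sum_nonneg mult_nonneg_nonneg)
  then show ?case by (simp only: funpow_mult_vec_Suc_nth)
qed (simp add: assms(2))

lemma funpow_mult_vec_axis_eq_0:
  fixes A :: "real^'n^'n"
  assumes band: "\<And>i j. Suc (idx i) < idx j \<Longrightarrow> A $ i $ j = 0"
  shows "idx i + k < idx b \<Longrightarrow> ((*v) A ^^ k) (axis b 1) $ i = 0"
proof (induction k arbitrary: i)
  case 0
  then show ?case by (auto simp: axis_def)
next
  case (Suc k)
  have "A $ i $ j * ((*v) A ^^ k) (axis b 1) $ j = 0" for j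
    using band[of i j] Suc.IH[of j] Suc.prems by (cases "Suc (idx i) < idx j") auto
  then show ?case unfolding funpow_mult_vec_Suc_nth by (intro sum.neutral) auto
qed

lemma funpow_mult_vec_axis_pos:
  fixes A :: "real^'n^'n"
  assumes nonneg: "\<And>i j. 0 \<le> A $ i $ j" and diag: "\<And>i. 0 < A $ i $ i"
    and succ: "\<And>i j. idx j = Suc (idx i) \<Longrightarrow> 0 < A $ i $ j"
    and idx: "bij_betw idx UNIV {0..<CARD('n)}"
  shows "idx i \<le> idx b \<Longrightarrow> idx b \<le> idx i + k \<Longrightarrow> 0 < ((*v) A ^^ k) (axis b 1) $ i"
proof (induction k arbitrary: i)
  case 0
  then have "i = b" using idx by (auto simp: bij_betw_def inj_on_def)
  then show ?case by simp
next
  case (Suc k)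
  let ?w = "((*v) A ^^ k) (axis b 1)"
  have terms: "0 \<le> A $ i $ j * ?w $ j" for j
    using nonneg funpow_mult_vec_nonneg[OF nonneg, of "axis b 1"] by (simp add: axis_def)
  obtain j where "0 < A $ i $ j * ?w $ j"
  proof (cases "idx b \<le> idx i + k")
    case True
    then show ?thesis using that[of i] diag Suc by simp
  next
    case False
    moreover have "idx b < CARD('n)" using idx by (auto simp: bij_betw_def)
    ultimately have "Suc (idx i) \<in> idx ` UNIV" using idx Suc.prems by (simp add: bij_betw_def)
    then obtain j where "idx j = Suc (idx i)" by auto
    then show ?thesis using that[of j] succ Suc False by simp
  qed
  also have "A $ i $ j * ?w $ j \<le> ((*v) A ^^ Suc k) (axis b 1) $ i"
    unfolding funpow_mult_vec_Suc_nth using terms by (intro member_le_sum) auto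
  finally show ?case .
qed

section \<open>A tridiagonal counterexample\<close>

definition bidiagonal_ones :: "('n::finite \<Rightarrow> nat) \<Rightarrow> real^'n^'n" where
  "bidiagonal_ones idx = (\<chi> i j. if idx j = idx i \<or> idx j = Suc (idx i) then 1 else 0)"

text \<open>A tridiagonal matrix (in the order \<open>idx\<close>) with positive diagonal and off-diagonal; the
  Gram form makes it positive definite.\<close>
definition tridiagonal_witness :: "('n::finite \<Rightarrow> nat) \<Rightarrow> real^'n^'n" where
  "tridiagonal_witness idx = bidiagonal_ones idx ** transpose (bidiagonal_ones idx) + mat 1"

lemma tridiagonal_witness_nth:
  "tridiagonal_witness idx $ i $ j
     = (\<Sum>k\<in>UNIV. bidiagonal_ones idx $ i $ k * bidiagonal_ones idx $ j $ k) + (if i = j then 1 else 0)"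
  by (simp add: tridiagonal_witness_def matrix_matrix_mult_def transpose_def mat_def)

lemma bidiagonal_ones_nonneg: "0 \<le> bidiagonal_ones idx $ i $ j"
  by (simp add: bidiagonal_ones_def)

lemma tridiagonal_witness_nonneg: "0 \<le> tridiagonal_witness idx $ i $ j"
  unfolding tridiagonal_witness_nth
  by (intro add_nonneg_nonneg sum_nonneg mult_nonneg_nonneg bidiagonal_ones_nonneg) auto

lemma tridiagonal_witness_eq_0:
  assumes "Suc (idx i) < idx j"
  shows "tridiagonal_witness idx $ i $ j = 0"
proof -
  have "(\<Sum>k\<in>UNIV. bidiagonal_ones idx $ i $ k * bidiagonal_ones idx $ j $ k) = 0"
    using assms by (intro sum.neutral) (auto simp: bidiagonal_ones_def)
  then show ?thesis using assms unfolding tridiagonal_witness_nth by auto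
qed

lemma tridiagonal_witness_diag_pos: "0 < tridiagonal_witness idx $ i $ i"
proof -
  have "0 \<le> (\<Sum>k\<in>UNIV. bidiagonal_ones idx $ i $ k * bidiagonal_ones idx $ i $ k)"
    by (intro sum_nonneg mult_nonneg_nonneg bidiagonal_ones_nonneg)
  then show ?thesis unfolding tridiagonal_witness_nth by simp
qed

lemma tridiagonal_witness_succ_pos:
  assumes "idx j = Suc (idx i)"
  shows "0 < tridiagonal_witness idx $ i $ j"
proof -
  have "bidiagonal_ones idx $ i $ j * bidiagonal_ones idx $ j $ j
      \<le> (\<Sum>k\<in>UNIV. bidiagonal_ones idx $ i $ k * bidiagonal_ones idx $ j $ k)"
    by (intro member_le_sum mult_nonneg_nonneg bidiagonal_ones_nonneg) auto
  moreover have "bidiagonal_ones idx $ i $ j * bidiagonal_ones idx $ j $ j = 1"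
    using assms by (simp add: bidiagonal_ones_def)
  ultimately show ?thesis unfolding tridiagonal_witness_nth using assms by auto
qed

lemma tridiagonal_witness_symmetric: "transpose (tridiagonal_witness idx) = tridiagonal_witness idx"
  by (simp add: vec_eq_iff transpose_def tridiagonal_witness_nth mult.commute eq_commute)

lemma tridiagonal_witness_quadratic_form: "v \<bullet> v \<le> v \<bullet> (tridiagonal_witness idx *v v)"
proof -
  let ?M = "bidiagonal_ones idx"
  have "tridiagonal_witness idx *v v = ?M *v (transpose ?M *v v) + v"
    by (simp add: tridiagonal_witness_def matrix_vector_mult_add_rdistrib matrix_vector_mul_assoc
        del: transpose_matrix_vector)
  then have "v \<bullet> (tridiagonal_witness idx *v v) = v \<bullet> (?M *v (transpose ?M *v v)) + v \<bullet> v"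
    by (simp add: inner_add_right)
  also have "v \<bullet> (?M *v (transpose ?M *v v)) = (v v* ?M) \<bullet> (transpose ?M *v v)"
    by (simp only: dot_lmul_matrix)
  also have "v v* ?M = transpose ?M *v v" by simp
  finally show ?thesis by simp
qed

lemma tridiagonal_witness_positive_definite: "v \<noteq> 0 \<Longrightarrow> 0 < v \<bullet> (tridiagonal_witness idx *v v)"
  using tridiagonal_witness_quadratic_form[of v idx] by (meson inner_gt_zero_iff order_less_le_trans)

lemma doubly_nonnegative_tridiagonal_witness: "doubly_nonnegative (tridiagonal_witness idx)"
  unfolding doubly_nonnegative_def
  using tridiagonal_witness_symmetric tridiagonal_witness_nonneg tridiagonal_witness_quadratic_form
  by (meson inner_ge_zero order_trans)

lemma mat_rpow_not_doubly_nonnegative: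
  assumes "2 \<le> CARD('n)" "real CARD('n) - 3 < t" "t < real CARD('n) - 2"
  shows "\<exists>A::real^'n^'n. doubly_nonnegative A \<and> \<not> doubly_nonnegative (mat_rpow A t)"
proof -
  define m where "m = CARD('n) - 2"
  have m: "card (UNIV :: 'n set) = m + 2" "real m - 1 < t" "t < real m"
    using assms unfolding m_def by (auto simp: of_nat_diff)
  obtain idx :: "'n \<Rightarrow> nat" where idx: "bij_betw idx UNIV {0..<CARD('n)}"
    using ex_bij_betw_finite_nat[of "UNIV :: 'n set"] by auto
  then have "0 \<in> idx ` UNIV" "m + 1 \<in> idx ` UNIV" using m(1) unfolding bij_betw_def by auto
  then obtain a b where a: "idx a = 0" and b: "idx b = m + 1" by (metis imageE)
  let ?A = "tridiagonal_witness idx"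
  have "\<exists>w s :: 'n \<Rightarrow> real. mat_rpow ?A t $ a $ b = exp_sum w s UNIV t \<and>
      (\<forall>k. ((*v) ?A ^^ k) (axis b 1) $ a = exp_sum w s UNIV (real k))"
    by (rule mat_rpow_nth_exp_sum[OF tridiagonal_witness_symmetric])
      (rule tridiagonal_witness_positive_definite)
  then obtain w s :: "'n \<Rightarrow> real" where entry: "mat_rpow ?A t $ a $ b = exp_sum w s UNIV t"
    and iterates: "\<And>k. ((*v) ?A ^^ k) (axis b 1) $ a = exp_sum w s UNIV (real k)"
    by blast
  have "((*v) ?A ^^ k) (axis b 1) $ a = 0" if "k \<le> m" for k
    using funpow_mult_vec_axis_eq_0[where A = ?A and idx = idx, OF tridiagonal_witness_eq_0] that a b
    by simp
  then have "\<forall>k\<le>m. exp_sum w s UNIV (real k) = 0" using iterates by simp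
  moreover have "0 < ((*v) ?A ^^ (m + 1)) (axis b 1) $ a"
    using a b by (intro funpow_mult_vec_axis_pos[where idx = idx] tridiagonal_witness_nonneg
        tridiagonal_witness_diag_pos tridiagonal_witness_succ_pos idx) auto
  then have "0 < exp_sum w s UNIV (real m + 1)" unfolding iterates by (simp add: add.commute)
  ultimately have "mat_rpow ?A t $ a $ b < 0"
    using exp_sum_neg_before_last_zero[where I = "UNIV :: 'n set" and m = m] m entry by simp
  then have "\<not> doubly_nonnegative (mat_rpow ?A t)"
    unfolding doubly_nonnegative_def by (meson not_le)
  then show ?thesis using doubly_nonnegative_tridiagonal_witness by blast
qed

theorem theorem3p2:
  shows "critical_exponent TYPE('n::finite) \<ge> ereal (real CARD('n) - 2)"
  unfolding critical_exponent_def
proof (rule Inf_greatest, clarify)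
  fix m assume "0 < m" and
    all_t: "\<forall>t\<ge>m. \<forall>A::real^'n^'n. doubly_nonnegative A \<longrightarrow> doubly_nonnegative (mat_rpow A t)"
  show "ereal (real CARD('n) - 2) \<le> ereal m"
  proof (rule ccontr)
    assume "\<not> ?thesis"
    then have "m < real CARD('n) - 2" by simp
    define t where "t = (max m (real CARD('n) - 3) + (real CARD('n) - 2)) / 2"
    have "2 \<le> CARD('n)" "real CARD('n) - 3 < t" "t < real CARD('n) - 2" "m \<le> t"
      using \<open>0 < m\<close> \<open>m < real CARD('n) - 2\<close> unfolding t_def by auto
    then show False using mat_rpow_not_doubly_nonnegative all_t by blast
  qed
qed

end
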